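(* Let $r$ be a polymatroid on a finite ground set $E$ and let $(L,G)$ be its generator enriched lattice of flats. The minors of $(L,G)$ are in bijection with the parallel closed pairs of $r$.
   Context: A polymatroid on $E$ is a function $r$ from subsets of $E$ to $\mathbb{R}_{\ge0}$ with $r(\emptyset)=0$, monotone under inclusion, and $r(X\cap Y)+r(X\cup Y)\le r(X)+r(Y)$. Closure: $\overline{X}=\{e\in E: r(X)=r(X\cup\{e\})\}$; flats are the sets $\overline X$, forming a lattice $L$ under inclusion (meet $\cap$, join $\overline{X\cup Y}$). The generator enriched lattice of flats is $(L,G)$ with $G=\{\overline{\{e\}}: r(\{e\})\ne0\}$. Minors of polymatroids: $r\setminus X$ is the restriction of $r$ to subsets of $E\setminus X$; $(r/X)(Z)=r(Z\cup X)-r(X)$ for $Z\subseteq E\setminus X$. Elements $e,f$ are parallel with respect to a polymatroid $t$ if $t(\{e,f\})=t(\{e\})=t(\{f\})$. A parallel closed pair of $r$ is a pair $(F,s)$ where $F\subseteq E$ is a flat of $r$ and $s$ is a polymatroid obtainable as a deletion $(r/F)\setminus Z$ ($Z\subseteq E\setminus F$) such that whenever $e\in E\setminus F$ is parallel with respect to $r/F$ to an element of the ground set of $s$, $e$ also lies in the ground set of $s$ (i.e. the ground set of $s$ is a union of parallel classes of $r/F$). A generator enriched lattice is a pair $(L,G)$ with $L$ a finite lattice and $G\subseteq L\setminus\{\widehat0\}$ generating $L$ under joins. For $H\subseteq L$ and $z<h$ for all $h\in H$, $\langle H|z\rangle=(\{z\}\cup\{\bigvee_{x\in S}x:\emptyset\ne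 S\subseteq H\},H)$. For $I\subseteq G$: deletion $(L,G)\setminus I=\langle G\setminus I|\widehat0_L\rangle$; with $i_0=\bigvee I$ and $J=\{g\vee i_0:g\in G\}\setminus\{i_0\}$, contraction $(L,G)/I=\langle J|i_0\rangle$. A minor of $(L,G)$ is the result of any finite sequence of deletions and contractions. *)

theory Defs
  imports Complex_Main "HOL-Algebra.Lattice"
begin

section \<open>Polymatroids\<close>

text \<open>
  A polymatroid is a pair of a ground set and a rank function. Only the values of the rank
  function on subsets of the ground set are meaningful; the minor operations below therefore
  return rank functions that are extensional on the power set of the new ground set, so that
  minors are equal as polymatroids iff they are equal as pairs.
\<close>

type_synonym 'e polymat = "'e set \<times> ('e set \<Rightarrow> real)"

definition polymatroid :: "'e polymat \<Rightarrow> bool" where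
  "polymatroid M \<longleftrightarrow> (case M of (E, r) \<Rightarrow>
     (\<forall>X \<subseteq> E. 0 \<le> r X) \<and>
     r {} = 0 \<and>
     (\<forall>X Y. X \<subseteq> Y \<and> Y \<subseteq> E \<longrightarrow> r X \<le> r Y) \<and>
     (\<forall>X Y. X \<subseteq> E \<and> Y \<subseteq> E \<longrightarrow> r (X \<inter> Y) + r (X \<union> Y) \<le> r X + r Y))"

definition pm_closure :: "'e polymat \<Rightarrow> 'e set \<Rightarrow> 'e set" where
  "pm_closure M X = (case M of (E, r) \<Rightarrow> {e \<in> E. r X = r (X \<union> {e})})"

definition pm_flats :: "'e polymat \<Rightarrow> 'e set set" where
  "pm_flats M = pm_closure M ` Pow (fst M)"

definition pm_deletion :: "'e polymat \<Rightarrow> 'e set \<Rightarrow> 'e polymat" where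
  "pm_deletion M X = (case M of (E, r) \<Rightarrow> (E - X, restrict r (Pow (E - X))))"

definition pm_contraction :: "'e polymat \<Rightarrow> 'e set \<Rightarrow> 'e polymat" where
  "pm_contraction M X = (case M of (E, r) \<Rightarrow>
     (E - X, restrict (\<lambda>Z. r (Z \<union> X) - r X) (Pow (E - X))))"

definition pm_parallel :: "'e polymat \<Rightarrow> 'e \<Rightarrow> 'e \<Rightarrow> bool" where
  "pm_parallel M e f \<longleftrightarrow> (case M of (E, t) \<Rightarrow>
     e \<in> E \<and> f \<in> E \<and> t {e, f} = t {e} \<and> t {e} = t {f})"

definition parallel_closed_pairs :: "'e polymat \<Rightarrow> ('e set \<times> 'e polymat) set" where
  "parallel_closed_pairs M = {(F, s).
     F \<in> pm_flats M \<and>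
     (\<exists>Z. Z \<subseteq> fst M - F \<and> s = pm_deletion (pm_contraction M F) Z) \<and>
     (\<forall>e \<in> fst M - F. \<forall>f \<in> fst s. pm_parallel (pm_contraction M F) e f \<longrightarrow> e \<in> fst s)}"

lemma polymatroid_restrict:
  assumes "\<And>A. A \<subseteq> E \<Longrightarrow> 0 \<le> t A" "t {} = 0" "\<And>A B. A \<subseteq> B \<Longrightarrow> B \<subseteq> E \<Longrightarrow> t A \<le> t B"
    and "\<And>A B. A \<subseteq> E \<Longrightarrow> B \<subseteq> E \<Longrightarrow> t (A \<inter> B) + t (A \<union> B) \<le> t A + t B"
  shows "polymatroid (E, restrict t (Pow E))"
proof -
  have *: "restrict t (Pow E) A = t A" if "A \<subseteq> E" for A using that by simp
  show ?thesis
    unfolding polymatroid_def prod.case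
  proof (intro conjI allI impI)
    fix A B assume AB: "A \<subseteq> B \<and> B \<subseteq> E"
    then have "A \<subseteq> E" by blast
    with AB show "restrict t (Pow E) A \<le> restrict t (Pow E) B" by (simp add: assms(3))
  next
    fix A B assume AB: "A \<subseteq> E \<and> B \<subseteq> E"
    then have "A \<inter> B \<subseteq> E" "A \<union> B \<subseteq> E" by auto
    with AB show "restrict t (Pow E) (A \<inter> B) + restrict t (Pow E) (A \<union> B)
        \<le> restrict t (Pow E) A + restrict t (Pow E) B"
      using assms(4)[of A B] by (simp only: *)
  qed (simp_all add: assms(1,2))
qed

lemma polymatroid_deletion:
  assumes "polymatroid (E, r)"
  shows "polymatroid (pm_deletion (E, r) X)"
  unfolding pm_deletion_def prod.case
proof (rule polymatroid_restrict)
  fix A B assume "A \<subseteq> E - X" "B \<subseteq> E - X"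
  then have "A \<subseteq> E" "B \<subseteq> E" by auto
  then show "r (A \<inter> B) + r (A \<union> B) \<le> r A + r B"
    using assms by (simp add: polymatroid_def)
next
  fix A B assume "A \<subseteq> B" "B \<subseteq> E - X"
  then have "A \<subseteq> B" "B \<subseteq> E" by auto
  then show "r A \<le> r B" using assms by (simp add: polymatroid_def)
next
  fix A assume "A \<subseteq> E - X"
  then have "A \<subseteq> E" by auto
  then show "0 \<le> r A" using assms by (simp add: polymatroid_def)
qed (use assms in \<open>simp add: polymatroid_def\<close>)

lemma polymatroid_contraction:
  assumes "polymatroid (E, r)" "X \<subseteq> E"
  shows "polymatroid (pm_contraction (E, r) X)"
  unfolding pm_contraction_def prod.case
proof (rule polymatroid_restrict)
  have mono: "r A \<le> r B" if "A \<subseteq> B" "B \<subseteq> E" for A B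
    using assms that by (simp add: polymatroid_def)
  show "0 \<le> r (A \<union> X) - r X" if "A \<subseteq> E - X" for A
    using mono[of X "A \<union> X"] that assms(2) by auto
  show "r (A \<union> X) - r X \<le> r (B \<union> X) - r X" if "A \<subseteq> B" "B \<subseteq> E - X" for A B
    using mono[of "A \<union> X" "B \<union> X"] that assms(2) by auto
next
  fix A B assume "A \<subseteq> E - X" "B \<subseteq> E - X"
  then have "A \<union> X \<subseteq> E" "B \<union> X \<subseteq> E" using assms(2) by auto
  then have "r ((A \<union> X) \<inter> (B \<union> X)) + r ((A \<union> X) \<union> (B \<union> X)) \<le> r (A \<union> X) + r (B \<union> X)"
    using assms(1) unfolding polymatroid_def prod.case by blast
  moreover have "(A \<union> X) \<inter> (B \<union> X) = (A \<inter> B) \<union> X" "(A \<union> X) \<union> (B \<union> X) = (A \<union> B) \<union> X"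
    by auto
  ultimately show "r (A \<inter> B \<union> X) - r X + (r (A \<union> B \<union> X) - r X)
      \<le> r (A \<union> X) - r X + (r (B \<union> X) - r X)" by simp
qed simp

section \<open>Generator enriched lattices\<close>

type_synonym 'a gen_lattice = "'a gorder \<times> 'a set"

definition generator_enriched_lattice :: "'a gen_lattice \<Rightarrow> bool" where
  "generator_enriched_lattice P \<longleftrightarrow> (case P of (L, G) \<Rightarrow>
     lattice L \<and> finite (carrier L) \<and> carrier L \<noteq> {} \<and>
     G \<subseteq> carrier L - {\<bottom>\<^bsub>L\<^esub>} \<and>
     (\<forall>x \<in> carrier L. \<exists>S \<subseteq> G. x = \<Squnion>\<^bsub>L\<^esub> S))"

text \<open>
  The pair \<open>\<langle>H|z\<rangle>\<close> inside \<open>L\<close>. The order is inherited from \<open>L\<close>, so such pairs are equal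
  iff they have the same elements and the same generators.
\<close>

definition gel_span :: "'a gorder \<Rightarrow> 'a set \<Rightarrow> 'a \<Rightarrow> 'a gen_lattice" where
  "gel_span L H z = (L\<lparr>carrier := {z} \<union> {\<Squnion>\<^bsub>L\<^esub> S | S. S \<noteq> {} \<and> S \<subseteq> H}\<rparr>, H)"

definition gel_deletion :: "'a gen_lattice \<Rightarrow> 'a set \<Rightarrow> 'a gen_lattice" where
  "gel_deletion P I = (case P of (L, G) \<Rightarrow> gel_span L (G - I) \<bottom>\<^bsub>L\<^esub>)"

definition gel_contraction :: "'a gen_lattice \<Rightarrow> 'a set \<Rightarrow> 'a gen_lattice" where
  "gel_contraction P I = (case P of (L, G) \<Rightarrow>
     let i = \<Squnion>\<^bsub>L\<^esub> I in gel_span L ({g \<squnion>\<^bsub>L\<^esub> i | g. g \<in> G} - {i}) i)"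

inductive_set gel_minors :: "'a gen_lattice \<Rightarrow> 'a gen_lattice set"
  for P :: "'a gen_lattice" where
  self: "P \<in> gel_minors P"
| deletion: "Q \<in> gel_minors P \<Longrightarrow> I \<subseteq> snd Q \<Longrightarrow> gel_deletion Q I \<in> gel_minors P"
| contraction: "Q \<in> gel_minors P \<Longrightarrow> I \<subseteq> snd Q \<Longrightarrow> gel_contraction Q I \<in> gel_minors P"

section \<open>The generator enriched lattice of flats\<close>

definition flat_order :: "'e polymat \<Rightarrow> 'e set gorder" where
  "flat_order M = \<lparr>carrier = pm_flats M, eq = (=), le = (\<subseteq>)\<rparr>"

definition flat_gens :: "'e polymat \<Rightarrow> 'e set set" where
  "flat_gens M = {pm_closure M {e} | e. e \<in> fst M \<and> snd M {e} \<noteq> 0}"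

definition lattice_of_flats :: "'e polymat \<Rightarrow> 'e set gen_lattice" where
  "lattice_of_flats M = (flat_order M, flat_gens M)"

lemma partial_order_flats: "partial_order (flat_order M)"
  by unfold_locales (auto simp: flat_order_def)

context
  fixes E :: "'e set" and r :: "'e set \<Rightarrow> real"
  assumes fin: "finite E" and pm: "polymatroid (E, r)"
begin

lemma rank_mono: "X \<subseteq> Y \<Longrightarrow> Y \<subseteq> E \<Longrightarrow> r X \<le> r Y"
  using pm by (simp add: polymatroid_def)

lemma rank_submodular: "X \<subseteq> E \<Longrightarrow> Y \<subseteq> E \<Longrightarrow> r (X \<inter> Y) + r (X \<union> Y) \<le> r X + r Y"
  using pm by (simp add: polymatroid_def)

lemma closure_subset_ground: "pm_closure (E, r) X \<subseteq> E"
  by (auto simp: pm_closure_def)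

lemma closure_extensive: "X \<subseteq> E \<Longrightarrow> X \<subseteq> pm_closure (E, r) X"
  by (auto simp: pm_closure_def insert_absorb)

lemma closure_mono:
  assumes "X \<subseteq> Y" "Y \<subseteq> E"
  shows "pm_closure (E, r) X \<subseteq> pm_closure (E, r) Y"
proof
  fix e assume e: "e \<in> pm_closure (E, r) X"
  then have eE: "e \<in> E" and re: "r X = r (X \<union> {e})" by (auto simp: pm_closure_def)
  show "e \<in> pm_closure (E, r) Y"
  proof (cases "e \<in> Y")
    case True
    then show ?thesis using closure_extensive assms by blast
  next
    case False
    have "Y \<inter> (X \<union> {e}) = X" "Y \<union> (X \<union> {e}) = Y \<union> {e}" using False assms by auto
    moreover have "r (Y \<inter> (X \<union> {e})) + r (Y \<union> (X \<union> {e})) \<le> r Y + r (X \<union> {e})"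
      by (rule rank_submodular) (use assms eE in auto)
    ultimately have "r (Y \<union> {e}) \<le> r Y" using re by simp
    moreover have "r Y \<le> r (Y \<union> {e})" by (rule rank_mono) (use assms eE in auto)
    ultimately show ?thesis using eE by (simp add: pm_closure_def)
  qed
qed

lemma rank_closure:
  assumes X: "X \<subseteq> E"
  shows "r (pm_closure (E, r) X) = r X"
proof -
  have "r (X \<union> A) = r X" if "finite A" "A \<subseteq> pm_closure (E, r) X" for A
    using that
  proof (induction A rule: finite_induct)
    case (insert a A)
    have AE: "X \<union> A \<subseteq> E" using insert.prems closure_subset_ground X by blast
    have "a \<in> pm_closure (E, r) (X \<union> A)"
      using insert.prems closure_mono[OF _ AE, of X] by auto
    then have "r (X \<union> A) = r (X \<union> insert a A)" by (simp add: pm_closure_def)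
    then show ?case using insert by simp
  qed simp
  from this[of "pm_closure (E, r) X"] show ?thesis
    using closure_extensive[OF X] finite_subset[OF closure_subset_ground fin]
    by (simp add: Un_absorb1)
qed

lemma closure_idem:
  assumes X: "X \<subseteq> E"
  shows "pm_closure (E, r) (pm_closure (E, r) X) = pm_closure (E, r) X"
proof
  show "pm_closure (E, r) (pm_closure (E, r) X) \<subseteq> pm_closure (E, r) X"
  proof
    fix e assume "e \<in> pm_closure (E, r) (pm_closure (E, r) X)"
    then have eE: "e \<in> E" and *: "r (pm_closure (E, r) X \<union> {e}) = r X"
      using rank_closure[OF X] by (auto simp: pm_closure_def[of _ "pm_closure (E, r) X"])
    have "r (X \<union> {e}) \<le> r (pm_closure (E, r) X \<union> {e})"
      by (rule rank_mono) (use closure_extensive[OF X] closure_subset_ground eE in auto)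
    moreover have "r X \<le> r (X \<union> {e})" by (rule rank_mono) (use X eE in auto)
    ultimately show "e \<in> pm_closure (E, r) X" using * eE by (simp add: pm_closure_def)
  qed
qed (rule closure_extensive[OF closure_subset_ground])

lemma flat_iff: "F \<in> pm_flats (E, r) \<longleftrightarrow> F \<subseteq> E \<and> pm_closure (E, r) F = F"
proof
  assume "F \<in> pm_flats (E, r)"
  then obtain X where "X \<subseteq> E" "F = pm_closure (E, r) X" by (auto simp: pm_flats_def)
  then show "F \<subseteq> E \<and> pm_closure (E, r) F = F"
    using closure_idem closure_subset_ground by simp
next
  assume "F \<subseteq> E \<and> pm_closure (E, r) F = F"
  then show "F \<in> pm_flats (E, r)" by (force simp: pm_flats_def)
qed

lemma closure_in_flats: "X \<subseteq> E \<Longrightarrow> pm_closure (E, r) X \<in> pm_flats (E, r)"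
  by (simp add: pm_flats_def)

lemma closure_minimal: "F \<in> pm_flats (E, r) \<Longrightarrow> X \<subseteq> F \<Longrightarrow> pm_closure (E, r) X \<subseteq> F"
  using closure_mono[of X F] flat_iff[of F] by simp

lemma flat_Int:
  assumes "A \<in> pm_flats (E, r)" "B \<in> pm_flats (E, r)"
  shows "A \<inter> B \<in> pm_flats (E, r)"
proof -
  have E: "A \<inter> B \<subseteq> E" using assms(1) flat_iff[of A] by auto
  have "pm_closure (E, r) (A \<inter> B) \<subseteq> A" "pm_closure (E, r) (A \<inter> B) \<subseteq> B"
    using assms by (auto intro!: closure_minimal del: subsetI)
  then have "pm_closure (E, r) (A \<inter> B) = A \<inter> B"
    using closure_extensive[OF E] by (intro equalityI Int_greatest)
  then show ?thesis using E flat_iff[of "A \<inter> B"] by simp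
qed

lemma least_Upper_flats:
  assumes "S \<subseteq> pm_flats (E, r)"
  shows "least (flat_order (E, r)) (pm_closure (E, r) (\<Union>S)) (Upper (flat_order (E, r)) S)"
proof -
  have U: "\<Union>S \<subseteq> E" using assms flat_iff by blast
  have eq: "Upper (flat_order (E, r)) S = {F \<in> pm_flats (E, r). \<Union>S \<subseteq> F}"
    using assms by (auto simp: Upper_def flat_order_def)
  show ?thesis
    unfolding least_def eq
    using closure_in_flats[OF U] closure_extensive[OF U] closure_minimal[of _ "\<Union>S"]
    by (simp add: flat_order_def)
qed

lemma sup_flats:
  assumes "S \<subseteq> pm_flats (E, r)"
  shows "\<Squnion>\<^bsub>flat_order (E, r)\<^esub> S = pm_closure (E, r) (\<Union>S)"
  unfolding Lattice.sup_def
proof (rule some_equality)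
  show least: "least (flat_order (E, r)) (pm_closure (E, r) (\<Union>S)) (Upper (flat_order (E, r)) S)"
    by (rule least_Upper_flats[OF assms])
  show "x = pm_closure (E, r) (\<Union>S)"
    if "least (flat_order (E, r)) x (Upper (flat_order (E, r)) S)" for x
    by (rule partial_order.least_unique[OF partial_order_flats that least])
qed

theorem lattice_of_flats_generator_enriched:
  "generator_enriched_lattice (lattice_of_flats (E, r))"
proof -
  let ?L = "flat_order (E, r)" and ?cl = "pm_closure (E, r)"
  interpret partial_order ?L by (rule partial_order_flats)
  have car: "carrier ?L = pm_flats (E, r)" by (simp add: flat_order_def)
  have "lattice ?L"
  proof unfold_locales
    fix A B assume "A \<in> carrier ?L" "B \<in> carrier ?L"
    then show "\<exists>s. least ?L s (Upper ?L {A, B})"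
      using least_Upper_flats[of "{A, B}"] car by auto
  next
    fix A B assume *: "A \<in> carrier ?L" "B \<in> carrier ?L"
    then have "greatest ?L (A \<inter> B) (Lower ?L {A, B})"
      using flat_Int[of A B] by (auto simp: greatest_def Lower_def flat_order_def)
    then show "\<exists>s. greatest ?L s (Lower ?L {A, B})" by blast
  qed
  moreover have "finite (carrier ?L)" "carrier ?L \<noteq> {}"
    using fin by (auto simp: car pm_flats_def)
  moreover have bot: "\<bottom>\<^bsub>?L\<^esub> = ?cl {}"
    using sup_flats[of "{}"] by (simp add: bottom_def Lattice.sup_def)
  moreover have rank_empty: "r {} = 0" using pm by (simp add: polymatroid_def)
  have gen_flat: "flat_gens (E, r) \<subseteq> pm_flats (E, r)"
    by (auto simp: flat_gens_def intro!: closure_in_flats)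
  moreover have "?cl {} \<notin> flat_gens (E, r)"
  proof
    assume "?cl {} \<in> flat_gens (E, r)"
    then obtain e where e: "e \<in> E" "r {e} \<noteq> 0" "?cl {} = ?cl {e}"
      by (auto simp: flat_gens_def)
    then have "e \<in> ?cl {}" using closure_extensive[of "{e}"] by auto
    then show False using e rank_empty by (simp add: pm_closure_def)
  qed
  moreover have "\<exists>S \<subseteq> flat_gens (E, r). F = \<Squnion>\<^bsub>?L\<^esub> S" if F: "F \<in> pm_flats (E, r)" for F
  proof -
    define S where "S = {?cl {e} | e. e \<in> F \<and> r {e} \<noteq> 0}"
    have FE: "F \<subseteq> E" using F flat_iff by blast
    have S: "S \<subseteq> flat_gens (E, r)" using FE by (auto simp: S_def flat_gens_def)
    then have US: "\<Union>S \<subseteq> E" using gen_flat flat_iff by blast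
    have sup: "\<Squnion>\<^bsub>?L\<^esub> S = ?cl (\<Union>S)" using sup_flats S gen_flat by blast
    have "\<Union>S \<subseteq> F" using closure_minimal[OF F] by (auto simp: S_def)
    then have "?cl (\<Union>S) \<subseteq> F" by (rule closure_minimal[OF F])
    moreover have "F \<subseteq> ?cl (\<Union>S)"
    proof
      fix e assume e: "e \<in> F"
      show "e \<in> ?cl (\<Union>S)"
      proof (cases "r {e} = 0")
        case True
        then have "e \<in> ?cl {}" using e FE rank_empty by (auto simp: pm_closure_def)
        then show ?thesis using closure_mono[of "{}" "\<Union>S"] US by auto
      next
        case False
        then have "?cl {e} \<in> S" using e by (auto simp: S_def)
        moreover have "e \<in> ?cl {e}" using closure_extensive[of "{e}"] e FE by auto
        ultimately show ?thesis using closure_extensive[OF US] by blast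
      qed
    qed
    ultimately show ?thesis using S sup by auto
  qed
  ultimately show ?thesis
    by (auto simp: generator_enriched_lattice_def lattice_of_flats_def car)
qed

end

end

theory Submission
  imports Defs
begin

text \<open>
  Every minor of the lattice of flats has the form \<open>\<langle>H|z\<rangle>\<close> with \<open>z\<close> a flat and \<open>H\<close> a set of
  flats \<open>cl (z \<union> {e})\<close> with \<open>e \<notin> z\<close>, and every such pair occurs: contract by all the generators
  below \<open>z\<close>, then delete. The minor determines \<open>H\<close>, and \<open>z\<close> as its least element. On the other
  side, \<open>e\<close> and \<open>f\<close> are parallel in \<open>r/z\<close> iff \<open>cl (z \<union> {e}) = cl (z \<union> {f})\<close>, so the sets \<open>H\<close>
  correspond to the unions of parallel classes of \<open>r/z\<close>.
\<close>

text \<open>The join is defined by a choice operator; antisymmetry leaves it only one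
  candidate.\<close>

lemma (in partial_order) sup_eqI:
  assumes "least L x (Upper L S)"
  shows "\<Squnion>\<^bsub>L\<^esub> S = x"
  unfolding Lattice.sup_def using assms by (rule some_equality) (rule least_unique[OF _ assms])

section \<open>Closures, flats and one-element joins\<close>

locale finite_polymatroid =
  fixes E :: "'e set" and r :: "'e set \<Rightarrow> real"
  assumes fin: "finite E" and pm: "polymatroid (E, r)"
begin

abbreviation cl :: "'e set \<Rightarrow> 'e set" where
  "cl \<equiv> pm_closure (E, r)"

abbreviation flats :: "'e set set" where
  "flats \<equiv> pm_flats (E, r)"

abbreviation L :: "'e set gorder" where
  "L \<equiv> flat_order (E, r)"

text \<open>The largest generator set occurring over the flat \<open>z\<close>: it is what remains
  of the generators when the lattice of flats is contracted to \<open>z\<close>, with one member for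
  each parallel class of \<open>r/z\<close>.\<close>

definition element_joins :: "'e set \<Rightarrow> 'e set set" where
  "element_joins z = (\<lambda>e. cl (insert e z)) ` (E - z)"

lemmas cl_ground = closure_subset_ground[OF fin pm]
lemmas cl_extensive = closure_extensive[OF fin pm]
lemmas cl_in_flats = closure_in_flats[OF fin pm]
lemmas sup_L = sup_flats[OF fin pm]

lemma flat_subset: "F \<in> flats \<Longrightarrow> F \<subseteq> E"
  using flat_iff[OF fin pm] by blast

lemma cl_flat: "F \<in> flats \<Longrightarrow> cl F = F"
  using flat_iff[OF fin pm] by blast

lemma cl_subset_iff: "F \<in> flats \<Longrightarrow> X \<subseteq> E \<Longrightarrow> cl X \<subseteq> F \<longleftrightarrow> X \<subseteq> F"
  using closure_minimal[OF fin pm] cl_extensive by blast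

text \<open>The closure of a set is the least flat containing it, so it depends only on which flats
  contain the set. Identities between nested closures thereby become elementary inclusions.\<close>

lemma cl_eqI:
  assumes "X \<subseteq> E" "Y \<subseteq> E" "\<And>F. F \<in> flats \<Longrightarrow> X \<subseteq> F \<longleftrightarrow> Y \<subseteq> F"
  shows "cl X = cl Y"
  using assms cl_subset_iff cl_in_flats by (metis subset_antisym subset_refl)

lemma element_joins_flats: "z \<in> flats \<Longrightarrow> element_joins z \<subseteq> flats"
  using flat_subset[of z] by (auto simp: element_joins_def intro!: cl_in_flats)

lemma element_joins_above: "z \<in> flats \<Longrightarrow> \<forall>h \<in> element_joins z. z \<subseteq> h"
  using flat_subset[of z] cl_extensive[of "insert _ z"] by (auto 4 3 simp: element_joins_def)

section \<open>Spans inside the lattice of flats\<close>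

text \<open>Since \<open>z\<close> lies below every generator, adding it to a nonempty union changes
  nothing, while \<open>T = {}\<close> yields \<open>z\<close> itself. This removes the special role
  of \<open>z\<close> in \<open>gel_span\<close>.\<close>

lemma carrier_span:
  assumes "z \<in> flats" "H \<subseteq> flats" "\<forall>h \<in> H. z \<subseteq> h"
  shows "carrier (fst (gel_span L H z)) = {cl (z \<union> \<Union>T) | T. T \<subseteq> H}"
proof -
  have ne: "\<Squnion>\<^bsub>L\<^esub> T = cl (z \<union> \<Union>T)" if "T \<subseteq> H" "T \<noteq> {}" for T
  proof -
    have "z \<union> \<Union>T = \<Union>T" using assms(3) that by blast
    then show ?thesis using sup_L[of T] that assms(2) by auto
  qed
  have empty: "z = cl (z \<union> \<Union>{})" using cl_flat[OF assms(1)] by simp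
  show ?thesis
  proof (intro equalityI subsetI)
    fix x assume "x \<in> carrier (fst (gel_span L H z))"
    then consider "x = z" | T where "T \<noteq> {}" "T \<subseteq> H" "x = \<Squnion>\<^bsub>L\<^esub> T"
      by (auto simp: gel_span_def)
    then show "x \<in> {cl (z \<union> \<Union>T) | T. T \<subseteq> H}"
      using ne empty by cases blast+
  next
    fix x assume "x \<in> {cl (z \<union> \<Union>T) | T. T \<subseteq> H}"
    then obtain T where T: "T \<subseteq> H" "x = cl (z \<union> \<Union>T)" by blast
    show "x \<in> carrier (fst (gel_span L H z))"
    proof (cases "T = {}")
      case True
      then show ?thesis using T empty by (simp add: gel_span_def)
    next
      case False
      then show ?thesis using T ne[of T] by (auto simp: gel_span_def)
    qed
  qed
qed

lemma carrier_spanE: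
  assumes "z \<in> flats" "H \<subseteq> flats" "\<forall>h \<in> H. z \<subseteq> h"
    and "x \<in> carrier (fst (gel_span L H z))"
  obtains T where "T \<subseteq> H" "x = cl (z \<union> \<Union>T)" "z \<union> \<Union>T \<subseteq> x" "x \<in> flats"
proof -
  obtain T where T: "T \<subseteq> H" "x = cl (z \<union> \<Union>T)"
    using assms(4) unfolding carrier_span[OF assms(1-3)] by blast
  have "z \<union> \<Union>T \<subseteq> E" using T(1) assms(1,2) flat_subset by blast
  then show thesis using that[OF T] T(2) cl_extensive cl_in_flats by blast
qed

text \<open>A span is closed under nonempty joins of \<open>L\<close>, so its joins are the ambient
  ones. Having \<open>z\<close> in the union also covers \<open>S = {}\<close>, whose join in the
  span is its own bottom \<open>z\<close>, not that of \<open>L\<close>.\<close>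

lemma sup_span:
  assumes "z \<in> flats" "H \<subseteq> flats" "\<forall>h \<in> H. z \<subseteq> h"
    and S: "S \<subseteq> carrier (fst (gel_span L H z))"
  shows "\<Squnion>\<^bsub>fst (gel_span L H z)\<^esub> S = cl (z \<union> \<Union>S)"
proof -
  let ?M = "fst (gel_span L H z)"
  note car = carrier_span[OF assms(1-3)]
  have le: "le ?M = (\<subseteq>)" "eq ?M = (=)" by (simp_all add: gel_span_def flat_order_def)
  interpret M: partial_order ?M
    by unfold_locales (auto simp: le)
  have HE: "z \<union> \<Union>T \<subseteq> E" if "T \<subseteq> H" for T using that assms(1,2) flat_subset by blast
  have flat: "x \<in> flats" and above: "z \<subseteq> x" if "x \<in> carrier ?M" for x
    using that by (auto elim: carrier_spanE[OF assms(1-3)])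
  have SE: "z \<union> \<Union>S \<subseteq> E" using S flat flat_subset assms(1) by blast
  \<comment> \<open>All generators below the ambient join. The generators that produce a member of
    \<open>S\<close> are among them, so \<open>z\<close> and \<open>T\<close> generate the ambient
    join, which therefore lies in the span.\<close>
  define T where "T = {h \<in> H. h \<subseteq> cl (z \<union> \<Union>S)}"
  have "x \<subseteq> cl (z \<union> \<Union>T)" if x: "x \<in> S" for x
  proof -
    have "x \<in> carrier ?M" using x S by blast
    then obtain U where U: "U \<subseteq> H" "x = cl (z \<union> \<Union>U)" "z \<union> \<Union>U \<subseteq> x"
      by (rule carrier_spanE[OF assms(1-3)])
    moreover have "x \<subseteq> cl (z \<union> \<Union>S)" using cl_extensive[OF SE] x by blast
    ultimately have "U \<subseteq> T" by (auto simp: T_def)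
    then show ?thesis using U(2) HE[of T] closure_mono[OF fin pm, of "z \<union> \<Union>U" "z \<union> \<Union>T"]
      by (force simp: T_def)
  qed
  moreover have TH: "T \<subseteq> H" by (auto simp: T_def)
  ultimately have "cl (z \<union> \<Union>S) \<subseteq> cl (z \<union> \<Union>T)"
    using SE HE[OF TH] cl_in_flats cl_extensive cl_subset_iff by (metis Sup_le_iff le_sup_iff)
  moreover have "cl (z \<union> \<Union>T) \<subseteq> cl (z \<union> \<Union>S)"
    using cl_in_flats[OF SE] HE[OF TH] cl_extensive[OF SE]
    by (subst cl_subset_iff) (auto simp: T_def)
  ultimately have "cl (z \<union> \<Union>S) \<in> carrier ?M" unfolding car using TH by blast
  moreover have "cl (z \<union> \<Union>S) \<subseteq> x" if "x \<in> carrier ?M" "\<Union>S \<subseteq> x" for x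
    using cl_subset_iff[OF flat SE] above that by blast
  moreover have "Upper ?M S = {x \<in> carrier ?M. \<Union>S \<subseteq> x}"
    using S unfolding Upper_def le by blast
  ultimately have "least ?M (cl (z \<union> \<Union>S)) (Upper ?M S)"
    using cl_extensive[OF SE] by (simp add: least_def le)
  then show ?thesis by (rule M.sup_eqI)
qed

lemma generators_in_carrier_span:
  assumes "z \<in> flats" "H \<subseteq> flats" "\<forall>h \<in> H. z \<subseteq> h"
  shows "insert z H \<subseteq> carrier (fst (gel_span L H z))"
proof -
  have "h \<in> carrier (fst (gel_span L H z))" if "h \<in> H" for h
  proof -
    have "h = cl (z \<union> \<Union>{h})" using that assms cl_flat by (simp add: Un_absorb1 subset_iff)
    then show ?thesis unfolding carrier_span[OF assms] using that by blast
  qed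
  then show ?thesis by (auto simp: gel_span_def)
qed

text \<open>Only nonempty joins enter \<open>gel_span\<close>, and these agree in the span and in
  \<open>L\<close>. Hence an operation carried out inside a span gives again a span in
  \<open>L\<close>, and iterated minors never leave this form.\<close>

lemma span_of_span:
  assumes "z \<in> flats" "H \<subseteq> flats" "\<forall>h \<in> H. z \<subseteq> h"
    and "w \<in> carrier (fst (gel_span L H z))" "K \<subseteq> carrier (fst (gel_span L H z))"
    and "\<And>k. k \<in> K \<Longrightarrow> w \<subseteq> k"
  shows "gel_span (fst (gel_span L H z)) K w = gel_span L K w"
proof -
  have flat: "x \<in> flats \<and> z \<subseteq> x" if "x \<in> carrier (fst (gel_span L H z))" for x
    using that by (auto elim: carrier_spanE[OF assms(1-3)])
  have "\<Squnion>\<^bsub>fst (gel_span L H z)\<^esub> S = \<Squnion>\<^bsub>L\<^esub> S" if S: "S \<noteq> {}" "S \<subseteq> K" for S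
  proof -
    have "S \<subseteq> flats" "z \<union> \<Union>S = \<Union>S" using S assms(5) flat by blast+
    then show ?thesis using sup_span[OF assms(1-3), of S] sup_L[of S] S assms(5) by auto
  qed
  then have "{\<Squnion>\<^bsub>fst (gel_span L H z)\<^esub> S | S. S \<noteq> {} \<and> S \<subseteq> K} = {\<Squnion>\<^bsub>L\<^esub> S | S. S \<noteq> {} \<and> S \<subseteq> K}"
    by (metis (no_types, lifting))
  then show ?thesis by (simp add: gel_span_def)
qed

section \<open>Deletion and contraction of spans\<close>

lemma gel_deletion_span:
  assumes "z \<in> flats" "H \<subseteq> flats" "\<forall>h \<in> H. z \<subseteq> h"
  shows "gel_deletion (gel_span L H z) I = gel_span L (H - I) z"
proof -
  let ?M = "fst (gel_span L H z)"
  have span: "gel_span L H z = (?M, H)" by (simp add: gel_span_def)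
  \<comment> \<open>The bottom is the join of the empty set, which \<open>sup_span\<close> evaluates
    to \<open>cl z\<close>.\<close>
  have "\<bottom>\<^bsub>?M\<^esub> = z"
    using sup_span[OF assms, of "{}"] cl_flat[OF assms(1)]
    by (simp add: bottom_def Lattice.sup_def)
  then have "gel_deletion (gel_span L H z) I = gel_span ?M (H - I) z"
    unfolding gel_deletion_def by (subst span) simp
  also have "\<dots> = gel_span L (H - I) z"
    by (rule span_of_span[OF assms]) (use generators_in_carrier_span[OF assms] assms(3) in auto)
  finally show ?thesis .
qed

text \<open>Here \<open>i\<close> is the join of \<open>I\<close> taken in the span: the summand
  \<open>z\<close> makes it \<open>z\<close> when \<open>I\<close> is empty. Joins of generators
  with \<open>i\<close> may be computed in \<open>L\<close>, and \<open>span_of_span\<close>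
  flattens the result.\<close>

lemma gel_contraction_span:
  assumes z: "z \<in> flats" and H: "H \<subseteq> flats" "\<forall>h \<in> H. z \<subseteq> h" and I: "I \<subseteq> H"
  defines "i \<equiv> cl (z \<union> \<Union>I)"
  shows "gel_contraction (gel_span L H z) I = gel_span L ((\<lambda>h. cl (h \<union> i)) ` H - {i}) i"
proof -
  let ?M = "fst (gel_span L H z)"
  note zH = z H
  have span: "gel_span L H z = (?M, H)" by (simp add: gel_span_def)
  note gens = generators_in_carrier_span[OF zH]
  have sup_I: "\<Squnion>\<^bsub>?M\<^esub> I = i"
    unfolding i_def using gens I by (intro sup_span[OF zH]) auto
  have i_car: "i \<in> carrier ?M"
    unfolding i_def carrier_span[OF zH] using I by blast
  have zIE: "z \<union> \<Union>I \<subseteq> E" using I H(1) z flat_subset by blast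
  have zi: "z \<subseteq> i" and iI: "\<Union>I \<subseteq> i" and iE: "i \<subseteq> E"
    using cl_extensive[OF zIE] cl_ground by (auto simp: i_def)
  have join: "h \<squnion>\<^bsub>?M\<^esub> i = cl (h \<union> i)" if "h \<in> H" for h
  proof -
    have "z \<union> \<Union>{h, i} = h \<union> i" using zi by auto
    then show ?thesis
      using sup_span[OF zH, of "{h, i}"] that gens i_car by (auto simp: join_def)
  qed
  have cl_car: "cl (h \<union> i) \<in> carrier ?M" if h: "h \<in> H" for h
  proof -
    have hE: "h \<subseteq> E" using h H(1) flat_subset by blast
    \<comment> \<open>Rewriting the join with \<open>i\<close> as a join of generators exhibits it
      as an element of the span.\<close>
    have "cl (h \<union> i) = cl (z \<union> \<Union>(insert h I))"
    proof (rule cl_eqI)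
      show "h \<union> i \<subseteq> E" "z \<union> \<Union>(insert h I) \<subseteq> E" using hE iE zIE by auto
      show "h \<union> i \<subseteq> F \<longleftrightarrow> z \<union> \<Union>(insert h I) \<subseteq> F" if "F \<in> flats" for F
        using cl_subset_iff[OF that zIE] by (auto simp: i_def)
    qed
    then show ?thesis unfolding carrier_span[OF zH] using h I by blast
  qed
  have "{h \<squnion>\<^bsub>?M\<^esub> i | h. h \<in> H} = (\<lambda>h. cl (h \<union> i)) ` H"
    using join by (auto simp: image_def)
  then have "gel_contraction (gel_span L H z) I = gel_span ?M ((\<lambda>h. cl (h \<union> i)) ` H - {i}) i"
    unfolding gel_contraction_def by (subst span) (simp add: Let_def sup_I)
  also have "\<dots> = gel_span L ((\<lambda>h. cl (h \<union> i)) ` H - {i}) i"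
  proof (rule span_of_span[OF zH i_car])
    show "(\<lambda>h. cl (h \<union> i)) ` H - {i} \<subseteq> carrier ?M" using cl_car by auto
    fix k assume "k \<in> (\<lambda>h. cl (h \<union> i)) ` H - {i}"
    then obtain h where h: "h \<in> H" "k = cl (h \<union> i)" by auto
    then have "h \<union> i \<subseteq> E" using H(1) flat_subset iE by blast
    then show "i \<subseteq> k" using cl_extensive h(2) by blast
  qed
  finally show ?thesis .
qed

text \<open>Joining \<open>i\<close> to \<open>cl (insert e z)\<close> absorbs \<open>z\<close> and
  gives \<open>cl (insert e i)\<close>, which collapses to \<open>i\<close> exactly when
  \<open>e \<in> i\<close>. Removing \<open>i\<close> thus discards just the elements of
  \<open>i\<close>, as the index set \<open>E - i\<close> requires.\<close>

lemma join_element_joins: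
  assumes "z \<in> flats" "i \<in> flats" "z \<subseteq> i"
  shows "(\<lambda>h. cl (h \<union> i)) ` element_joins z - {i} = element_joins i"
proof -
  have join: "cl (cl (insert e z) \<union> i) = cl (insert e i)" if "e \<in> E" for e
  proof (rule cl_eqI)
    have ez: "insert e z \<subseteq> E" using that assms(1) flat_subset by blast
    show "cl (insert e z) \<union> i \<subseteq> E" "insert e i \<subseteq> E"
      using that cl_ground flat_subset[OF assms(2)] by auto
    show "cl (insert e z) \<union> i \<subseteq> F \<longleftrightarrow> insert e i \<subseteq> F" if "F \<in> flats" for F
      using cl_subset_iff[OF that ez] assms(3) by auto
  qed
  have "cl (insert e i) = i \<longleftrightarrow> e \<in> i" if "e \<in> E" for e
    using that cl_extensive[of "insert e i"] flat_subset[OF assms(2)] cl_flat[OF assms(2)]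
    by (auto simp: insert_absorb)
  then show ?thesis
    using join assms(3) by (auto simp: element_joins_def image_iff) blast+
qed

section \<open>The minors of the lattice of flats as spans\<close>

text \<open>The least flat \<open>cl {}\<close> consists of the elements of rank 0, so both sides
  range over the same elements; it lies in every flat, so joining it to \<open>e\<close> changes
  nothing.\<close>

lemma element_joins_loops: "element_joins (cl {}) = flat_gens (E, r)"
proof -
  have "r {} = 0" using pm by (simp add: polymatroid_def)
  then have loop: "e \<in> cl {} \<longleftrightarrow> r {e} = 0" if "e \<in> E" for e
    using that by (auto simp: pm_closure_def)
  have "cl (insert e (cl {})) = cl {e}" if "e \<in> E" for e
  proof (rule cl_eqI)
    show "insert e (cl {}) \<subseteq> E" "{e} \<subseteq> E" using that cl_ground by auto
    show "insert e (cl {}) \<subseteq> F \<longleftrightarrow> {e} \<subseteq> F" if "F \<in> flats" for F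
      using cl_subset_iff[OF that, of "{}"] by auto
  qed
  then show ?thesis
    using loop by (auto simp: element_joins_def flat_gens_def image_iff)
qed

text \<open>Every flat is a join of members of \<open>flat_gens\<close>, so the span over
  \<open>cl {}\<close> has all flats as its carrier. This puts the initial lattice in the form
  shared by its minors.\<close>

lemma lattice_of_flats_eq_span:
  "lattice_of_flats (E, r) = gel_span L (element_joins (cl {})) (cl {})"
proof -
  have z: "cl {} \<in> flats" by (simp add: cl_in_flats)
  note zH = z element_joins_flats[OF z] element_joins_above[OF z]
  have "flats \<subseteq> {cl (cl {} \<union> \<Union>T) | T. T \<subseteq> element_joins (cl {})}"
  proof
    fix F assume F: "F \<in> flats"
    obtain T where T: "T \<subseteq> flat_gens (E, r)" "F = \<Squnion>\<^bsub>L\<^esub> T"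
    proof -
      have "\<forall>x \<in> carrier L. \<exists>S \<subseteq> flat_gens (E, r). x = \<Squnion>\<^bsub>L\<^esub> S"
        using lattice_of_flats_generator_enriched[OF fin pm]
        by (simp add: generator_enriched_lattice_def lattice_of_flats_def)
      then show thesis using F that by (auto simp: flat_order_def)
    qed
    have TF: "T \<subseteq> flats" using T(1) element_joins_flats[OF z] element_joins_loops by blast
    then have TE: "\<Union>T \<subseteq> E" using flat_subset by blast
    have "cl (cl {} \<union> \<Union>T) = cl (\<Union>T)"
    proof (rule cl_eqI)
      show "cl {} \<union> \<Union>T \<subseteq> E" using cl_ground TE by auto
      show "cl {} \<union> \<Union>T \<subseteq> F \<longleftrightarrow> \<Union>T \<subseteq> F" if "F \<in> flats" for F
        using cl_subset_iff[OF that, of "{}"] by auto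
    qed (rule TE)
    then show "F \<in> {cl (cl {} \<union> \<Union>T) | T. T \<subseteq> element_joins (cl {})}"
      using T sup_L[OF TF] element_joins_loops by auto
  qed
  moreover have "{cl (cl {} \<union> \<Union>T) | T. T \<subseteq> element_joins (cl {})} \<subseteq> flats"
    using element_joins_flats[OF z] flat_subset cl_ground by (blast intro: cl_in_flats)
  ultimately have "carrier (fst (gel_span L (element_joins (cl {})) (cl {}))) = flats"
    using carrier_span[OF zH] by simp
  then show ?thesis
    by (simp add: lattice_of_flats_def gel_span_def element_joins_loops flat_order_def)
qed

text \<open>From left to right by induction on the operations: deletion shrinks \<open>H\<close>
  over the same \<open>z\<close>, and contraction moves \<open>z\<close> up to \<open>i\<close>,
  where \<open>join_element_joins\<close> keeps the new generators among the element joins of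
  \<open>i\<close>.\<close>

lemma gel_minors_lattice_of_flats:
  "gel_minors (lattice_of_flats (E, r)) =
    {gel_span L H z | H z. z \<in> flats \<and> H \<subseteq> element_joins z}" (is "?minors = ?spans")
proof
  show "?minors \<subseteq> ?spans"
  proof
    fix Q assume "Q \<in> ?minors"
    then show "Q \<in> ?spans"
    proof induction
      case self
      have "cl {} \<in> flats" by (simp add: cl_in_flats)
      then show ?case using lattice_of_flats_eq_span by blast
    next
      case (deletion Q I)
      then obtain H z where Hz: "Q = gel_span L H z" "z \<in> flats" "H \<subseteq> element_joins z" by blast
      have H: "H \<subseteq> flats" "\<forall>h \<in> H. z \<subseteq> h"
        using Hz element_joins_flats element_joins_above by blast+
      have "gel_deletion Q I = gel_span L (H - I) z"
        using gel_deletion_span[OF Hz(2) H] Hz(1) by simp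
      then show ?case using Hz by blast
    next
      case (contraction Q I)
      then obtain H z where Hz: "Q = gel_span L H z" "z \<in> flats" "H \<subseteq> element_joins z" by blast
      define i where "i = cl (z \<union> \<Union>I)"
      have H: "H \<subseteq> flats" "\<forall>h \<in> H. z \<subseteq> h"
        using Hz element_joins_flats element_joins_above by blast+
      have I: "I \<subseteq> H" using contraction Hz by (simp add: gel_span_def)
      have "z \<union> \<Union>I \<subseteq> E" using I H(1) Hz(2) flat_subset by blast
      then have i: "i \<in> flats" "z \<subseteq> i" using cl_in_flats cl_extensive unfolding i_def by blast+
      have "gel_contraction Q I = gel_span L ((\<lambda>h. cl (h \<union> i)) ` H - {i}) i"
        using gel_contraction_span[OF Hz(2) H I] Hz(1) by (simp add: i_def)
      moreover have "(\<lambda>h. cl (h \<union> i)) ` H - {i} \<subseteq> element_joins i"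
        using join_element_joins[OF Hz(2) i] Hz(3) by blast
      ultimately show ?case using i by blast
    qed
  qed
  show "?spans \<subseteq> ?minors"
  proof
    fix Q assume "Q \<in> ?spans"
    then obtain H z where Q: "Q = gel_span L H z" and z: "z \<in> flats" and Hz: "H \<subseteq> element_joins z"
      by blast
    let ?o = "cl {}"
    have o: "?o \<in> flats" by (simp add: cl_in_flats)
    note oH = o element_joins_flats[OF o] element_joins_above[OF o]
    have oz: "?o \<subseteq> z" using cl_subset_iff[OF z] by simp
    have span: "gel_span L (element_joins ?o) ?o \<in> ?minors"
      using gel_minors.self[of "lattice_of_flats (E, r)"] lattice_of_flats_eq_span by simp
    \<comment> \<open>Each \<open>e\<close> in \<open>z\<close> is either a loop or lies in
      \<open>cl (insert e ?o)\<close>, a member of \<open>I\<close>. So these generators fill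
      \<open>z\<close>, and contracting them moves the base exactly to \<open>z\<close>.\<close>
    define I where "I = {h \<in> element_joins ?o. h \<subseteq> z}"
    have I: "I \<subseteq> element_joins ?o" by (auto simp: I_def)
    have "?o \<union> \<Union>I = z"
    proof
      show "?o \<union> \<Union>I \<subseteq> z" using oz by (auto simp: I_def)
      show "z \<subseteq> ?o \<union> \<Union>I"
      proof
        fix e assume e: "e \<in> z"
        have eo: "insert e ?o \<subseteq> E" using e flat_subset[OF z] cl_ground by auto
        have "cl (insert e ?o) \<subseteq> z" using cl_subset_iff[OF z eo] e oz by simp
        moreover have "e \<in> cl (insert e ?o)" using cl_extensive[OF eo] by simp
        ultimately show "e \<in> ?o \<union> \<Union>I" using eo by (auto simp: I_def element_joins_def)
      qed
    qed
    then have contr: "gel_contraction (gel_span L (element_joins ?o) ?o) I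
        = gel_span L (element_joins z) z"
      using gel_contraction_span[OF oH I] join_element_joins[OF o z oz] cl_flat[OF z] by simp
    have "gel_span L (element_joins z) z \<in> ?minors"
      using gel_minors.contraction[OF span, of I] I contr by (simp add: gel_span_def)
    then have "gel_deletion (gel_span L (element_joins z) z) (element_joins z - H) \<in> ?minors"
      by (rule gel_minors.deletion) (auto simp: gel_span_def)
    moreover have "element_joins z - (element_joins z - H) = H" using Hz by blast
    ultimately show "Q \<in> ?minors"
      using gel_deletion_span[OF z element_joins_flats[OF z] element_joins_above[OF z]] Q
      by simp
  qed
qed

text \<open>The generators are a component of the pair, and the base is the intersection of all
  flats in the carrier.\<close>

lemma span_eq_iff:
  assumes "z \<in> flats" "H \<subseteq> element_joins z" "w \<in> flats" "K \<subseteq> element_joins w"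
  shows "gel_span L H z = gel_span L K w \<longleftrightarrow> H = K \<and> z = w"
proof -
  have least: "\<Inter>(carrier (fst (gel_span L A x))) = x"
    if x: "x \<in> flats" "A \<subseteq> element_joins x" for A x
  proof -
    have A: "A \<subseteq> flats" "\<forall>h \<in> A. x \<subseteq> h"
      using x element_joins_flats element_joins_above by blast+
    have "\<forall>y \<in> carrier (fst (gel_span L A x)). x \<subseteq> y"
      by (auto elim: carrier_spanE[OF x(1) A])
    moreover have "x \<in> carrier (fst (gel_span L A x))" by (simp add: gel_span_def)
    ultimately show ?thesis by blast
  qed
  show ?thesis
  proof
    assume eq: "gel_span L H z = gel_span L K w"
    then have "H = K" by (simp add: gel_span_def)
    moreover have "z = w" using least[OF assms(1,2)] least[OF assms(3,4)] eq by simp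
    ultimately show "H = K \<and> z = w" by simp
  qed simp
qed

section \<open>Parallel elements and closed pairs\<close>

text \<open>The right-hand closure is a flat containing \<open>F\<close>, so the inclusion only asks
  whether it contains \<open>e\<close>; by definition of closure this is an equality of
  ranks.\<close>

lemma cl_insert_subset_iff:
  assumes "F \<subseteq> E" "e \<in> E" "f \<in> E"
  shows "cl (insert e F) \<subseteq> cl (insert f F) \<longleftrightarrow> r (insert e (insert f F)) = r (insert f F)"
proof -
  have fF: "insert f F \<subseteq> E" "insert e F \<subseteq> E" using assms by auto
  have "cl (insert e F) \<subseteq> cl (insert f F) \<longleftrightarrow> e \<in> cl (insert f F)"
    using cl_subset_iff[OF cl_in_flats[OF fF(1)] fF(2)] cl_extensive[OF fF(1)] by auto
  also have "\<dots> \<longleftrightarrow> r (insert e (insert f F)) = r (insert f F)"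
    using assms by (auto simp: pm_closure_def)
  finally show ?thesis .
qed

text \<open>The constant \<open>r F\<close> cancels, and the two equalities of ranks that remain are
  the two inclusions between the closures.\<close>

lemma parallel_contraction_iff:
  assumes "F \<subseteq> E" "e \<in> E - F" "f \<in> E - F"
  shows "pm_parallel (pm_contraction (E, r) F) e f \<longleftrightarrow> cl (insert e F) = cl (insert f F)"
proof -
  have "pm_parallel (pm_contraction (E, r) F) e f \<longleftrightarrow>
      r (insert e (insert f F)) = r (insert e F) \<and> r (insert e (insert f F)) = r (insert f F)"
    using assms by (auto simp: pm_parallel_def pm_contraction_def)
  then show ?thesis
    using cl_insert_subset_iff[of F e f] cl_insert_subset_iff[of F f e] assms
    by (auto simp: insert_commute)
qed

text \<open>Pairs are parametrised by the surviving ground set \<open>A\<close> instead of the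
  deleted set, with parallelism replaced by equality of closures.\<close>

lemma parallel_closed_pairs_eq:
  "parallel_closed_pairs (E, r) =
    {(F, pm_deletion (pm_contraction (E, r) F) (E - F - A)) | F A. F \<in> flats \<and> A \<subseteq> E - F \<and>
      (\<forall>e \<in> E - F. \<forall>f \<in> A. cl (insert e F) = cl (insert f F) \<longrightarrow> e \<in> A)}"
proof -
  have ground: "fst (pm_deletion (pm_contraction (E, r) F) Z) = E - F - Z" for F Z
    by (simp add: pm_deletion_def pm_contraction_def)
  show ?thesis
  proof (intro equalityI subsetI)
    fix p assume "p \<in> parallel_closed_pairs (E, r)"
    then obtain F Z where p: "p = (F, pm_deletion (pm_contraction (E, r) F) Z)" "F \<in> flats"
      "Z \<subseteq> E - F" and
      closed: "\<forall>e \<in> E - F. \<forall>f \<in> E - F - Z. pm_parallel (pm_contraction (E, r) F) e f \<longrightarrow> e \<in> E - F - Z"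
      by (auto simp: parallel_closed_pairs_def ground)
    have "Z = E - F - (E - F - Z)" using p(3) by blast
    moreover have "\<forall>e \<in> E - F. \<forall>f \<in> E - F - Z. cl (insert e F) = cl (insert f F) \<longrightarrow> e \<in> E - F - Z"
      using closed parallel_contraction_iff[OF flat_subset[OF p(2)]] by blast
    ultimately show "p \<in> {(F, pm_deletion (pm_contraction (E, r) F) (E - F - A)) | F A.
        F \<in> flats \<and> A \<subseteq> E - F \<and>
        (\<forall>e \<in> E - F. \<forall>f \<in> A. cl (insert e F) = cl (insert f F) \<longrightarrow> e \<in> A)}"
      unfolding mem_Collect_eq using p(1,2) Diff_subset
      by (intro exI[of _ F] exI[of _ "E - F - Z"] conjI) auto
  next
    fix p assume "p \<in> {(F, pm_deletion (pm_contraction (E, r) F) (E - F - A)) | F A.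
        F \<in> flats \<and> A \<subseteq> E - F \<and>
        (\<forall>e \<in> E - F. \<forall>f \<in> A. cl (insert e F) = cl (insert f F) \<longrightarrow> e \<in> A)}"
    then obtain F A where p: "p = (F, pm_deletion (pm_contraction (E, r) F) (E - F - A))"
      "F \<in> flats" "A \<subseteq> E - F" and
      closed: "\<forall>e \<in> E - F. \<forall>f \<in> A. cl (insert e F) = cl (insert f F) \<longrightarrow> e \<in> A"
      by blast
    have A: "E - F - (E - F - A) = A" using p(3) by blast
    have "\<forall>e \<in> E - F. \<forall>f \<in> A. pm_parallel (pm_contraction (E, r) F) e f \<longrightarrow> e \<in> A"
      using closed parallel_contraction_iff[OF flat_subset[OF p(2)]] p(3) by blast
    then show "p \<in> parallel_closed_pairs (E, r)"
      unfolding p(1) parallel_closed_pairs_def mem_Collect_eq prod.case ground A fst_conv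
      using p(2) by (intro conjI exI[of _ "E - F - A"]) auto
  qed
qed

section \<open>The bijection\<close>

text \<open>On a parallel closed pair this gives one generator for each parallel class in the ground
  set of the second component.\<close>

definition pair_minor :: "'e set \<times> 'e polymat \<Rightarrow> 'e set gen_lattice" where
  "pair_minor p = gel_span L ((\<lambda>e. cl (insert e (fst p))) ` fst (snd p)) (fst p)"

lemma pair_minor_deletion:
  assumes "A \<subseteq> E - F"
  shows "pair_minor (F, pm_deletion (pm_contraction (E, r) F) (E - F - A))
    = gel_span L ((\<lambda>e. cl (insert e F)) ` A) F"
proof -
  have "E - F - (E - F - A) = A" using assms by blast
  then show ?thesis by (simp add: pair_minor_def pm_deletion_def pm_contraction_def)
qed

lemma bij_betw_pair_minor:
  "bij_betw pair_minor (parallel_closed_pairs (E, r)) (gel_minors (lattice_of_flats (E, r)))"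
proof (rule bij_betw_imageI)
  have image: "(\<lambda>e. cl (insert e F)) ` A \<subseteq> element_joins F" if "A \<subseteq> E - F" for A F
    using that by (auto simp: element_joins_def)
  show "inj_on pair_minor (parallel_closed_pairs (E, r))"
  proof (rule inj_onI)
    fix p q assume "p \<in> parallel_closed_pairs (E, r)" "q \<in> parallel_closed_pairs (E, r)"
      and eq: "pair_minor p = pair_minor q"
    then obtain F A F' B where
      p: "p = (F, pm_deletion (pm_contraction (E, r) F) (E - F - A))" "F \<in> flats" "A \<subseteq> E - F"
        "\<forall>e \<in> E - F. \<forall>f \<in> A. cl (insert e F) = cl (insert f F) \<longrightarrow> e \<in> A" and
      q: "q = (F', pm_deletion (pm_contraction (E, r) F') (E - F' - B))" "F' \<in> flats" "B \<subseteq> E - F'"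
        "\<forall>e \<in> E - F'. \<forall>f \<in> B. cl (insert e F') = cl (insert f F') \<longrightarrow> e \<in> B"
      unfolding parallel_closed_pairs_eq by blast
    have "gel_span L ((\<lambda>e. cl (insert e F)) ` A) F = gel_span L ((\<lambda>e. cl (insert e F')) ` B) F'"
      using eq unfolding p(1) q(1) pair_minor_deletion[OF p(3)] pair_minor_deletion[OF q(3)] .
    then have "F = F'" and im: "(\<lambda>e. cl (insert e F)) ` A = (\<lambda>e. cl (insert e F')) ` B"
      using span_eq_iff[OF p(2) image[OF p(3)] q(2) image[OF q(3)]] by auto
    have "A = B"
    proof
      show "A \<subseteq> B"
      proof
        fix e assume "e \<in> A"
        \<comment> \<open>Equal generators only show that \<open>e\<close> is parallel to some
          \<open>f\<close> in \<open>B\<close>; closedness of \<open>B\<close> then yields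
          \<open>e\<close> itself.\<close>
        then obtain f where "f \<in> B" "cl (insert e F) = cl (insert f F')" using im by blast
        then show "e \<in> B" using q(4) \<open>F = F'\<close> p(3) \<open>e \<in> A\<close> by blast
      qed
      show "B \<subseteq> A"
      proof
        fix e assume "e \<in> B"
        then obtain f where "f \<in> A" "cl (insert e F') = cl (insert f F)" using im by blast
        then show "e \<in> A" using p(4) \<open>F = F'\<close> q(3) \<open>e \<in> B\<close> by blast
      qed
    qed
    then show "p = q" using p(1) q(1) \<open>F = F'\<close> by simp
  qed
  show "pair_minor ` parallel_closed_pairs (E, r) = gel_minors (lattice_of_flats (E, r))"
    unfolding gel_minors_lattice_of_flats
  proof (intro equalityI subsetI)
    fix Q assume "Q \<in> pair_minor ` parallel_closed_pairs (E, r)"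
    then obtain F A where "F \<in> flats" "A \<subseteq> E - F"
      "Q = pair_minor (F, pm_deletion (pm_contraction (E, r) F) (E - F - A))"
      unfolding parallel_closed_pairs_eq by blast
    then show "Q \<in> {gel_span L H z | H z. z \<in> flats \<and> H \<subseteq> element_joins z}"
      using image pair_minor_deletion by blast
  next
    fix Q assume "Q \<in> {gel_span L H z | H z. z \<in> flats \<and> H \<subseteq> element_joins z}"
    then obtain H z where Q: "Q = gel_span L H z" "z \<in> flats" "H \<subseteq> element_joins z" by blast
    \<comment> \<open>Taking the full preimage of \<open>H\<close> makes \<open>A\<close> a union of
      parallel classes.\<close>
    define A where "A = {e \<in> E - z. cl (insert e z) \<in> H}"
    have A: "A \<subseteq> E - z" by (auto simp: A_def)
    have "(\<lambda>e. cl (insert e z)) ` A = H"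
      using Q(3) by (auto simp: A_def element_joins_def)
    then have "Q = pair_minor (z, pm_deletion (pm_contraction (E, r) z) (E - z - A))"
      using pair_minor_deletion[OF A] Q(1) by simp
    moreover have "\<forall>e \<in> E - z. \<forall>f \<in> A. cl (insert e z) = cl (insert f z) \<longrightarrow> e \<in> A"
      by (simp add: A_def)
    ultimately show "Q \<in> pair_minor ` parallel_closed_pairs (E, r)"
      unfolding parallel_closed_pairs_eq using Q(2) A by blast
  qed
qed

end

theorem mainTheorem11:
  fixes E :: "'e set" and r :: "'e set \<Rightarrow> real"
  assumes "finite E"
    and "polymatroid (E, r)"
  shows "\<exists>\<phi>. bij_betw \<phi> (gel_minors (lattice_of_flats (E, r))) (parallel_closed_pairs (E, r))"
proof -
  interpret finite_polymatroid E r
    using assms by unfold_locales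
  \<comment> \<open>The map constructed runs from pairs to minors, so its inverse is the one
    required.\<close>
  show ?thesis
    using bij_betw_inv_into[OF bij_betw_pair_minor] by blast
qed

end
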